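(* Let $q$ be an odd prime with $q\equiv 3\pmod 4$ and let $d\ge2$. Then there exists a subset $E\subset\mathbb{F}_q^d$ with $1<\sharp E<q^d$ such that $E$ is a translational tiling set for $\mathbb{F}_q^d$, $E$ has a spectrum, and $E^*:=E\setminus\{0\}$ is a multiplicative tiling set for $\mathbb{F}_q^d$.
   Context: $\mathbb{F}_q$ is the field with $q$ elements and $\mathrm{Aut}(\mathbb{F}_q^d)$ is the set of automorphisms (invertible linear maps) of $\mathbb{F}_q^d$. A set $F\subseteq\mathbb{F}_q^d$ is a translational tiling set if there is $\Lambda\subseteq\mathbb{F}_q^d$ with $\mathbb{F}_q^d=\bigcup_{\lambda\in\Lambda}(F+\lambda)$ as a disjoint union. A set $G\subseteq\mathbb{F}_q^d$ is a multiplicative tiling set if there is $\mathcal{A}\subseteq\mathrm{Aut}(\mathbb{F}_q^d)$ with $\mathbb{F}_q^d\setminus\{0\}=\bigcup_{\alpha\in\mathcal{A}}\alpha(G)$ as a disjoint union. $E$ has a spectrum if there is $L\subseteq\mathbb{F}_q^d$ such that the characters $\chi_l(x)=e^{2\pi i\, l\cdot x/q}$, $l\in L$, restricted to $E$, form an orthogonal basis of $L^2(E)$ (equivalently, $\{(\sharp E)^{-1/2}\chi_l\}_{l\in L}$ is an orthonormal basis of $L^2(E)$ for counting measure). *)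

theory Defs
  imports
    "HOL-Analysis.Analysis"
    "HOL-Number_Theory.Cong"
    "Berlekamp_Zassenhaus.Finite_Field"
begin

text \<open>For prime \<open>q = CARD('q)\<close> and \<open>d = CARD('d)\<close>, the space of \<open>d\<close>-tuples over the field with
  \<open>q\<close> elements is the type \<open>'q mod_ring ^ 'd\<close>.\<close>

definition Aut :: "(('q::prime_card) mod_ring ^ 'd \<Rightarrow> 'q mod_ring ^ 'd) set" where
  "Aut = {\<alpha>. Vector_Spaces.linear (*s) (*s) \<alpha> \<and> bij \<alpha>}"

text \<open>Disjointness of the two unions below is that of the indexed families, so distinct indices
  give disjoint (and not merely distinct or equal) pieces.\<close>

definition translational_tiling_set :: "(('q::prime_card) mod_ring ^ 'd) set \<Rightarrow> bool" where
  "translational_tiling_set F \<longleftrightarrow>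
     (\<exists>\<Lambda>. (\<Union>t\<in>\<Lambda>. (\<lambda>x. x + t) ` F) = UNIV \<and> disjoint_family_on (\<lambda>t. (\<lambda>x. x + t) ` F) \<Lambda>)"

definition multiplicative_tiling_set :: "(('q::prime_card) mod_ring ^ 'd) set \<Rightarrow> bool" where
  "multiplicative_tiling_set G \<longleftrightarrow>
     (\<exists>\<A>\<subseteq>Aut. (\<Union>\<alpha>\<in>\<A>. \<alpha> ` G) = UNIV - {0} \<and> disjoint_family_on (\<lambda>\<alpha>. \<alpha> ` G) \<A>)"

definition dot :: "('q::prime_card) mod_ring ^ 'd \<Rightarrow> 'q mod_ring ^ 'd \<Rightarrow> 'q mod_ring" where
  "dot l x = (\<Sum>i\<in>UNIV. l $ i * x $ i)"

text \<open>The exponential depends on \<open>dot l x\<close> only modulo \<open>q\<close>; \<open>to_int_mod_ring\<close> picks the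
  representative in \<open>{0..<q}\<close>.\<close>

definition chi :: "('q::prime_card) mod_ring ^ 'd \<Rightarrow> 'q mod_ring ^ 'd \<Rightarrow> complex" where
  "chi l x = exp (2 * of_real pi * \<i> * of_int (to_int_mod_ring (dot l x)) / of_nat CARD('q))"

definition L2_inner :: "'a set \<Rightarrow> ('a \<Rightarrow> complex) \<Rightarrow> ('a \<Rightarrow> complex) \<Rightarrow> complex" where
  "L2_inner E f g = (\<Sum>x\<in>E. f x * cnj (g x))"

text \<open>Elements of \<open>L\<^sup>2(E)\<close>, for finite \<open>E\<close> with counting measure, are represented by functions on
  the ambient type of which only the values on \<open>E\<close> matter. The family \<open>u\<close> is indexed by the
  finite set \<open>L\<close>; the three conjuncts are orthogonality, linear independence and spanning.\<close>

definition orthogonal_basis_L2 :: "'a set \<Rightarrow> 'b set \<Rightarrow> ('b \<Rightarrow> 'a \<Rightarrow> complex) \<Rightarrow> bool" where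
  "orthogonal_basis_L2 E L u \<longleftrightarrow>
     (\<forall>l\<in>L. \<forall>m\<in>L. l \<noteq> m \<longrightarrow> L2_inner E (u l) (u m) = 0) \<and>
     (\<forall>c. (\<forall>x\<in>E. (\<Sum>l\<in>L. c l * u l x) = 0) \<longrightarrow> (\<forall>l\<in>L. c l = 0)) \<and>
     (\<forall>f. \<exists>c. \<forall>x\<in>E. f x = (\<Sum>l\<in>L. c l * u l x))"

definition has_spectrum :: "(('q::prime_card) mod_ring ^ 'd) set \<Rightarrow> bool" where
  "has_spectrum E \<longleftrightarrow> (\<exists>L. orthogonal_basis_L2 E L chi)"

end

theory Submission imports Defs begin

text \<open>
  A coordinate line \<open>E\<close> works. It is a subgroup, so it tiles with the complementary coordinate
  hyperplane as the set of translations. Restricted to \<open>E\<close>, the characters indexed by \<open>E\<close> itself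
  are exactly the characters of the cyclic group of order \<open>q\<close>, so finite Fourier inversion
  makes them an orthogonal basis; all of this comes down to the vanishing of nontrivial character
  sums (\<open>sum_add_char_mult\<close>). Finally, the punctured lines through the origin partition
  the nonzero vectors, and the automorphisms act transitively on nonzero vectors
  (\<open>Aut_axis_to_nonzero\<close>). Hence one automorphism for each line, carrying \<open>E\<close> to that line, gives
  a multiplicative tiling. The cardinality of \<open>E\<close> is \<open>q\<close>, which lies strictly between \<open>1\<close> and \<open>q^d\<close>
  because \<open>d \<ge> 2\<close>.
\<close>

lemma translational_tiling_set_range_axis:
  "translational_tiling_set (range (axis i) :: (('q::prime_card) mod_ring ^ 'd::finite) set)"
proof -
  let ?H = "{t :: 'q mod_ring ^ 'd. t $ i = 0}"
  have "x \<in> (\<Union>t\<in>?H. (\<lambda>y. y + t) ` range (axis i))" for x :: "'q mod_ring ^ 'd"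
  proof (rule UN_I)
    show "x - axis i (x $ i) \<in> ?H" by (simp add: axis_def)
    show "x \<in> (\<lambda>y. y + (x - axis i (x $ i))) ` range (axis i)"
      by (rule image_eqI[where x = "axis i (x $ i)"]) auto
  qed
  moreover have "t = u"
    if "t \<in> ?H" "u \<in> ?H" "axis i a + t = axis i b + u" for t u :: "'q mod_ring ^ 'd" and a b
  proof -
    have "a = b" using arg_cong[OF that(3), of "\<lambda>v. v $ i"] that(1,2) by (simp add: axis_def)
    then show "t = u" using that(3) by simp
  qed
  then have "disjoint_family_on (\<lambda>t. (\<lambda>y. y + t) ` range (axis i)) ?H"
    unfolding disjoint_family_on_def by blast
  ultimately show ?thesis
    unfolding translational_tiling_set_def by blast
qed

definition add_char :: "('q::prime_card) mod_ring \<Rightarrow> complex" where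
  "add_char a = exp (2 * of_real pi * \<i> * of_int (to_int_mod_ring a) / of_nat CARD('q))"

lemma chi_axis: "chi (axis i a) x = add_char (a * x $ i)"
proof -
  have "dot (axis i a) x = (\<Sum>j\<in>UNIV. if j = i then a * x $ i else 0)"
    unfolding dot_def by (intro sum.cong) (auto simp: axis_def)
  then show ?thesis by (simp add: chi_def add_char_def)
qed

lemma add_char_add: "add_char (a + b) = add_char a * add_char (b :: ('q::prime_card) mod_ring)"
proof -
  let ?q = "int CARD('q)"
  let ?s = "to_int_mod_ring a + to_int_mod_ring b"
  have "to_int_mod_ring (a + b) = ?s mod ?q"
    by transfer simp
  then have s: "?s = to_int_mod_ring (a + b) + ?q * (?s div ?q)"
    by simp
  have "add_char a * add_char b
      = exp (2 * of_real pi * \<i> * of_int ?s / of_nat CARD('q))"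
    by (simp add: add_char_def flip: exp_add add_divide_distrib distrib_left of_int_add)
  also have "2 * of_real pi * \<i> * of_int ?s / of_nat CARD('q)
      = 2 * of_real pi * \<i> * of_int (to_int_mod_ring (a + b)) / of_nat CARD('q)
        + 2 * of_int (?s div ?q) * of_real pi * \<i>"
    by (subst s) (simp add: field_simps)
  also have "exp \<dots> = add_char (a + b)"
    unfolding exp_add add_char_def by (simp add: exp_eq_1)
  finally show ?thesis by simp
qed

lemma add_char_0: "add_char 0 = 1"
  by (simp add: add_char_def)

lemma cnj_add_char: "cnj (add_char a) = add_char (- a)"
proof -
  have "cnj (add_char a) * add_char a = 1"
    by (simp add: add_char_def exp_cnj flip: exp_add)
  moreover have "add_char (- a) * add_char a = 1"
    by (simp add: add_char_0 flip: add_char_add)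
  ultimately show ?thesis
    by (metis mult_cancel_right mult_zero_right zero_neq_one)
qed

lemma add_char_eq_1_iff: "add_char a = 1 \<longleftrightarrow> a = (0 :: ('q::prime_card) mod_ring)"
proof
  assume "add_char a = 1"
  then obtain n :: int where "2 * pi * of_int (to_int_mod_ring a) / of_nat CARD('q) = of_int (2 * n) * pi"
    by (auto simp: add_char_def exp_eq_1)
  then have "real_of_int (to_int_mod_ring a) = of_int (n * int CARD('q))"
    by (simp add: field_simps)
  then have "to_int_mod_ring a = n * int CARD('q)"
    by (simp only: of_int_eq_iff)
  moreover have "0 \<le> to_int_mod_ring a \<and> to_int_mod_ring a < int CARD('q)"
    by transfer auto
  ultimately have "to_int_mod_ring a = 0"
    by (metis mod_mult_self2_is_0 mod_pos_pos_trivial)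
  then show "a = 0" by simp
qed (simp add: add_char_0)

text \<open>For \<open>b \<noteq> 0\<close>, the substitution \<open>a \<mapsto> 1 + a\<close> multiplies the sum by \<open>add_char b\<close>, which is
  not \<open>1\<close>.\<close>

lemma sum_add_char_mult:
  fixes b :: "('q::prime_card) mod_ring"
  shows "(\<Sum>a\<in>UNIV. add_char (a * b)) = (if b = 0 then of_nat CARD('q) else 0)"
proof (cases "b = 0")
  case True
  then show ?thesis by (simp add: add_char_0)
next
  case False
  have "(\<Sum>a\<in>UNIV. add_char (a * b)) = (\<Sum>a\<in>UNIV. add_char ((1 + a) * b))"
    by (rule sum.reindex_bij_witness[where i = "\<lambda>a. 1 + a" and j = "\<lambda>a. a - 1"]) auto
  also have "\<dots> = add_char b * (\<Sum>a\<in>UNIV. add_char (a * b))"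
    by (simp add: distrib_right add_char_add sum_distrib_left)
  finally show ?thesis
    using False add_char_eq_1_iff[of b] by simp
qed

lemma sum_add_char_mult_cnj:
  fixes b c :: "('q::prime_card) mod_ring"
  shows "(\<Sum>a\<in>UNIV. add_char (a * b) * cnj (add_char (a * c))) = (if b = c then of_nat CARD('q) else 0)"
  using sum_add_char_mult[of "b - c"]
  by (simp add: cnj_add_char right_diff_distrib flip: add_char_add)

lemma sum_range_axis: "(\<Sum>x\<in>range (axis i). f x) = (\<Sum>a\<in>UNIV. f (axis i a))"
  by (subst sum.reindex) (auto simp: inj_def axis_eq_axis)

text \<open>The line is its own spectrum: \<open>sum_add_char_mult_cnj\<close> applied to the points gives
  orthogonality of the characters, and applied to the frequencies it is Fourier inversion, by which
  the characters span.\<close>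

lemma has_spectrum_range_axis:
  "has_spectrum (range (axis i) :: (('q::prime_card) mod_ring ^ 'd::finite) set)"
proof -
  let ?E = "range (axis i) :: ('q mod_ring ^ 'd) set"
  let ?q = "of_nat CARD('q) :: complex"
  have chi2: "chi (axis i a) (axis i b :: 'q mod_ring ^ 'd) = add_char (a * b)" for a b
    by (subst chi_axis) (simp add: axis_def)
  have orth: "L2_inner ?E (chi (axis i a)) (chi (axis i b)) = (if a = b then ?q else 0)" for a b
    using sum_add_char_mult_cnj[of a b] by (simp add: L2_inner_def sum_range_axis chi2 mult.commute)
  have "c (axis i b) = 0" if "\<forall>x\<in>?E. (\<Sum>l\<in>?E. c l * chi l x) = 0" for b c
  proof -
    have "0 = L2_inner ?E (\<lambda>x. \<Sum>l\<in>?E. c l * chi l x) (chi (axis i b))"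
      using that by (simp add: L2_inner_def sum_range_axis)
    also have "\<dots> = (\<Sum>l\<in>?E. c l * L2_inner ?E (chi l) (chi (axis i b)))"
      unfolding L2_inner_def sum_distrib_left sum_distrib_right
      by (subst sum.swap) (simp add: mult.assoc)
    also have "\<dots> = c (axis i b) * ?q"
      by (simp add: sum_range_axis orth if_distrib[where f = "(*) _"] cong: if_cong)
    finally show ?thesis by simp
  qed
  moreover have "\<exists>c. \<forall>x\<in>?E. f x = (\<Sum>l\<in>?E. c l * chi l x)" for f :: "'q mod_ring ^ 'd \<Rightarrow> complex"
  proof (intro exI ballI)
    fix x assume "x \<in> ?E"
    then obtain b where x: "x = axis i b" by blast
    have "(\<Sum>l\<in>?E. L2_inner ?E f (chi l) / ?q * chi l x)
        = (\<Sum>a\<in>UNIV. \<Sum>y\<in>UNIV. f (axis i y) / ?q * (add_char (a * b) * cnj (add_char (a * y))))"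
      by (simp add: x L2_inner_def sum_range_axis chi2 sum_distrib_left sum_divide_distrib mult_ac)
    also have "\<dots> = (\<Sum>y\<in>UNIV. f (axis i y) / ?q * (\<Sum>a\<in>UNIV. add_char (a * b) * cnj (add_char (a * y))))"
      by (subst sum.swap) (simp add: sum_distrib_left)
    also have "\<dots> = f x"
      by (simp add: sum_add_char_mult_cnj x if_distrib[where f = "(*) _"] cong: if_cong)
    finally show "f x = (\<Sum>l\<in>?E. L2_inner ?E f (chi l) / ?q * chi l x)" by simp
  qed
  ultimately show ?thesis
    unfolding has_spectrum_def orthogonal_basis_L2_def using orth
    by (intro exI[of _ ?E]) (auto simp: axis_eq_axis)
qed

text \<open>If \<open>v $ j \<noteq> 0\<close>, replacing the \<open>j\<close>-th standard basis vector by \<open>v\<close> gives a basis; the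
  automorphism exchanges the coordinates \<open>i\<close> and \<open>j\<close> and then maps the \<open>j\<close>-th basis vector to \<open>v\<close>.\<close>

lemma Aut_axis_to_nonzero:
  fixes v :: "('q::prime_card) mod_ring ^ 'd::finite"
  assumes "v \<noteq> 0"
  obtains \<alpha> where "\<alpha> \<in> Aut" "\<And>c. \<alpha> (axis i c) = c *s v"
proof -
  obtain j where j: "v $ j \<noteq> 0" using assms by (auto simp: vec_eq_iff)
  define \<alpha> where "\<alpha> x = (\<chi> k. x $ (Transposition.transpose i j k) + x $ i * (v - axis j 1) $ k)"
    for x :: "'q mod_ring ^ 'd"
  have lin: "Vector_Spaces.linear (*s) (*s) \<alpha>"
    by unfold_locales (auto simp: \<alpha>_def vec_eq_iff algebra_simps)
  have "x = 0" if "\<alpha> x = 0" for x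
  proof -
    have "\<alpha> x $ j = x $ i * v $ j" by (simp add: \<alpha>_def algebra_simps)
    then have xi: "x $ i = 0" using that j by simp
    show ?thesis
    proof (simp only: vec_eq_iff, rule allI)
      fix k
      have "\<alpha> x $ (Transposition.transpose i j k) = x $ k" by (simp add: \<alpha>_def xi)
      then show "x $ k = 0 $ k" using that by simp
    qed
  qed
  then have "inj \<alpha>" using vec.linear_inj_iff_eq_0[OF lin] by blast
  then have "bij \<alpha>" by (simp add: bij_def finite_UNIV_inj_surj)
  moreover have "\<alpha> (axis i c) = c *s v" for c
    by (auto simp: \<alpha>_def vec_eq_iff axis_def Transposition.transpose_def algebra_simps)
  ultimately show thesis using that lin by (auto simp: Aut_def)
qed

text \<open>The lines through the origin are the projective points: \<open>rep v\<close> chooses one nonzero vector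
  on the line of \<open>v\<close>, depending only on that line.\<close>

lemma multiplicative_tiling_set_range_axis:
  "multiplicative_tiling_set (range (axis i) - {0} :: (('q::prime_card) mod_ring ^ 'd::finite) set)"
proof -
  let ?E = "range (axis i) - {0} :: ('q mod_ring ^ 'd) set"
  define line where "line v = {c *s v | c. c \<noteq> 0}" for v :: "'q mod_ring ^ 'd"
  define rep where "rep v = (SOME w. w \<in> line v)" for v
  have mem_line: "line v \<noteq> {}" for v
    by (auto simp: line_def intro: exI[of _ 1])
  have line_eq: "line w = line v" if w: "w \<in> line v" for v w
  proof -
    obtain c where c: "c \<noteq> 0" "w = c *s v" using w by (auto simp: line_def)
    have "a *s v = (a / c) *s w" "a *s w = (a * c) *s v" for a
      using c by (simp_all add: vector_smult_assoc)
    then show ?thesis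
      using c(1) unfolding line_def by (metis divide_eq_0_iff mult_eq_0_iff)
  qed
  have line_rep: "line (rep v) = line v" for v
    using mem_line line_eq unfolding rep_def by (metis some_in_eq)
  have mem_self: "v \<in> line v" for v
    unfolding line_def by (auto intro!: exI[of _ 1])
  have "\<forall>v. v \<noteq> 0 \<longrightarrow> (\<exists>\<alpha>. \<alpha> \<in> Aut \<and> (\<forall>c. \<alpha> (axis i c) = c *s (v :: 'q mod_ring ^ 'd)))"
    by (metis Aut_axis_to_nonzero)
  then obtain A where A: "\<And>v. v \<noteq> 0 \<Longrightarrow> A v \<in> Aut"
      "\<And>v c. v \<noteq> 0 \<Longrightarrow> A v (axis i c) = c *s (v :: 'q mod_ring ^ 'd)"
    by metis
  have E: "?E = axis i ` (UNIV - {0})"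
    by (auto simp: axis_eq_0_iff)
  have img: "A v ` ?E = line v" if "v \<noteq> 0" for v
    unfolding E image_image line_def using A(2)[OF that] by auto
  have line0: "0 \<notin> line v" if "v \<noteq> 0" for v
    using that by (auto simp: line_def)
  have rep0: "rep v \<noteq> 0" if "v \<noteq> 0" for v
    using mem_self[of "rep v"] line0[OF that] line_rep[of v] by auto
  have img_rep: "A (rep v) ` ?E = line v" if "v \<noteq> 0" for v
    using img[OF rep0[OF that]] line_rep by simp
  let ?A = "(\<lambda>v. A (rep v)) ` (UNIV - {0})"
  have "?A \<subseteq> Aut" using A(1) rep0 by auto
  moreover have "(\<Union>\<alpha>\<in>?A. \<alpha> ` ?E) = UNIV - {0}"
  proof -
    have "(\<Union>\<alpha>\<in>?A. \<alpha> ` ?E) = (\<Union>v\<in>UNIV - {0}. line v)"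
      using img_rep by simp
    also have "\<dots> = UNIV - {0}" using mem_self line0 by auto
    finally show ?thesis .
  qed
  moreover have "disjoint_family_on (\<lambda>\<alpha>. \<alpha> ` ?E) ?A"
  proof (unfold disjoint_family_on_def, intro ballI impI)
    fix \<alpha> \<beta> assume "\<alpha> \<in> ?A" "\<beta> \<in> ?A" "\<alpha> \<noteq> \<beta>"
    then obtain v w where vw: "v \<noteq> 0" "w \<noteq> 0" "\<alpha> = A (rep v)" "\<beta> = A (rep w)" by blast
    then have "line v \<noteq> line w" using \<open>\<alpha> \<noteq> \<beta>\<close> by (auto simp: rep_def)
    then have "line v \<inter> line w = {}" using line_eq by blast
    then show "\<alpha> ` ?E \<inter> \<beta> ` ?E = {}" using vw img_rep by simp
  qed
  ultimately show ?thesis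
    unfolding multiplicative_tiling_set_def by blast
qed

theorem theorem4p4:
  fixes q d :: nat
  assumes "CARD('q::prime_card) = q" and "CARD('d::finite) = d"
    and "prime q" and "odd q" and "[q = 3] (mod 4)" and "d \<ge> 2"
  shows "\<exists>E :: ('q mod_ring ^ 'd) set.
           1 < card E \<and> card E < q ^ d \<and>
           translational_tiling_set E \<and>
           has_spectrum E \<and>
           multiplicative_tiling_set (E - {0})"
proof -
  obtain i :: 'd where True by blast
  let ?E = "range (axis i) :: ('q mod_ring ^ 'd) set"
  have "card ?E = CARD('q mod_ring)"
    by (rule card_image) (auto simp: inj_def axis_eq_axis)
  then have "card ?E = q" using assms(1) by simp
  moreover have "1 < q" using \<open>prime q\<close> prime_gt_1_nat by blast
  moreover have "q < q ^ d"
    using power_strict_increasing[of 1 d q] \<open>1 < q\<close> \<open>d \<ge> 2\<close> by simp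
  ultimately show ?thesis
    using translational_tiling_set_range_axis has_spectrum_range_axis
      multiplicative_tiling_set_range_axis
    by (intro exI[of _ ?E] conjI) (auto simp only:)
qed

end
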